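(* Fix one of the three Latin squares $\otimes\in\{\otimes_1,\otimes_2,\otimes_3\}$ on the pole set $\mathbb{A}=\{R,G,B\}$, let $\odot$ be the corresponding multiplication on the colour space $\triangle$, and let $\mathbf{1}$ be its unit. With equality in $\triangle$ understood with respect to the Cancellation law: 1. $(\triangle,\oplus,\odot,\mathfrak{O},\mathbf{1})$ is a commutative ring with zero $\mathfrak{O}$ and unit $\mathbf{1}$, with a partial division (for $\mathbf{x}\in\triangle$ and $\mathbf{y}\in\triangle\setminus\mathfrak{S}$ the quotient of $\mathbf{x}$ by $\mathbf{y}$ exists). 2. $(\triangle,\oplus,\mathfrak{O})$ is an abelian group. 3. The set $\mathfrak{S}$ is an ideal of $\triangle$, and the nonzero elements of the factor ring $\triangle|\mathfrak{S}$ form an abelian group under $\odot$ with unit (the class of) $\mathbf{1}$. 4. Addition and multiplication are linked by the distributive law, from both sides. 5. $(\triangle|\mathfrak{S},\oplus,\odot,\mathfrak{S},\mathbf{1})$ is a field, with zero $\mathfrak{S}$ and unit (the class of) $\mathbf{1}$.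
   Context: Triangular coefficients: $T=\{q+\psi\varepsilon : q\in[0,\infty),\ \psi:[0,\infty)\to\mathbb{R}\}$, where $\varepsilon$ is the parabolic imaginary unit ($\varepsilon^2=0$), with $[a+b\varepsilon]+[A+B\varepsilon]=[a+A]+[b+B]\varepsilon$ and $[a+b\varepsilon]\cdot[A+B\varepsilon]=aA+[aB+Ab]\varepsilon$ (real functions are added and scaled pointwise). Poles: $\mathbb{A}=\{R,G,B\}\subset\mathbb{C}$ with $R=1$, $G=-\frac12+\frac{\sqrt3}{2}\imath$, $B=-\frac12-\frac{\sqrt3}{2}\imath$, so that $R+G+B=0$. Colour space: $\triangle$ is the set of expressions $R\tau_1+G\tau_2+B\tau_3$ with $\tau_1,\tau_2,\tau_3\in T$. Cancellation law: two expressions are regarded as equal if they become identical after adding to each of them a suitable element of the form $R\tau+G\tau+B\tau$ ($\tau\in T$), i.e. $R\tau_1+G\tau_2+B\tau_3=R\tau_1'+G\tau_2'+B\tau_3'$ iff there are $\tau,\tau'\in T$ with $\tau_i+\tau=\tau_i'+\tau'$ for $i=1,2,3$. All equalities and operations in $\triangle$ are understood modulo this congruence ("with respect to the Cancellation law"). The set $\mathfrak{O}=\{R\tau+G\tau+B\tau:\tau\in T\}$ plays the role of zero. Addition: $(R\tau_1+G\tau_2+B\tau_3)\oplus(R\tau_1'+G\tau_2'+B\tau_3')=R(\tau_1+\tau_1')+G(\tau_2+\tau_2')+B(\tau_3+\tau_3')$. Additive inverse: $\ominus(R\tau_1+G\tau_2+B\tau_3)=R(\tau_2+\tau_3)+G(\tau_1+\tau_3)+B(\tau_1+\tau_2)$.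 Latin squares (commutative compositions of poles): $\otimes_1$: $R\otimes R=R$, $R\otimes G=G$, $R\otimes B=B$, $G\otimes G=B$, $G\otimes B=R$, $B\otimes B=G$; $\otimes_2$: $R\otimes R=G$, $R\otimes G=B$, $R\otimes B=R$, $G\otimes G=R$, $G\otimes B=G$, $B\otimes B=B$; $\otimes_3$: $R\otimes R=B$, $R\otimes G=R$, $R\otimes B=G$, $G\otimes G=G$, $G\otimes B=B$, $B\otimes B=R$. Multiplication for a chosen $\otimes$: writing $A^{(1)}=R,A^{(2)}=G,A^{(3)}=B$, $\left(\sum_i A^{(i)}\tau_i\right)\odot\left(\sum_j A^{(j)}\tau_j'\right)=\sum_{i,j}[A^{(i)}\otimes A^{(j)}](\tau_i\cdot\tau_j')$. Unit: $\mathbf{1}$ is the element having coefficient $1+0\varepsilon$ at the pole that is neutral for $\otimes$ ($R$ for $\otimes_1$, $B$ for $\otimes_2$, $G$ for $\otimes_3$) and coefficients $0+0\varepsilon$ at the other two poles. $\mathfrak{S}=\{R[a+\rho\varepsilon]+G[a+\gamma\varepsilon]+B[a+\beta\varepsilon] : a\in[0,\infty),\ \rho,\gamma,\beta:[0,\infty)\to\mathbb{R}\}\subset\triangle$. $\triangle|\mathfrak{S}$ denotes the factor (quotient) of $\triangle$ by $\mathfrak{S}$. The quotient of $\mathbf{x}$ by $\mathbf{y}$ is the element $\mathbf{x}\odot\mathbf{z}$, where $\mathbf{z}\in\triangle$ satisfies $\mathbf{y}\odot\mathbf{z}=\mathbf{1}$. *)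

theory Defs
  imports Complex_Main "HOL-Algebra.QuotRing" "HOL-Algebra.Multiplicative_Group"
begin

typedef nnreal = "{x::real. 0 \<le> x}"
  morphisms real_of_nnreal Abs_nnreal
  by auto

setup_lifting type_definition_nnreal

instantiation nnreal :: comm_semiring_1
begin

lift_definition zero_nnreal :: nnreal is 0 by simp
lift_definition one_nnreal :: nnreal is 1 by simp
lift_definition plus_nnreal :: "nnreal \<Rightarrow> nnreal \<Rightarrow> nnreal" is "(+)" by simp
lift_definition times_nnreal :: "nnreal \<Rightarrow> nnreal \<Rightarrow> nnreal" is "(*)" by simp

instance
  by standard (transfer; simp add: algebra_simps)+

end

text \<open>Triangular coefficients: \<open>Tri q \<psi>\<close> stands for \<open>q + \<psi> \<epsilon>\<close>, where \<open>\<epsilon>\<^sup>2 = 0\<close>.\<close>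

datatype tri = Tri (tri_re: nnreal) (tri_eps: "nnreal \<Rightarrow> real")

instantiation tri :: comm_semiring_1
begin

definition zero_tri :: tri where "0 = Tri 0 (\<lambda>t. 0)"

definition one_tri :: tri where "1 = Tri 1 (\<lambda>t. 0)"

definition plus_tri :: "tri \<Rightarrow> tri \<Rightarrow> tri" where
  "x + y = Tri (tri_re x + tri_re y) (\<lambda>t. tri_eps x t + tri_eps y t)"

definition times_tri :: "tri \<Rightarrow> tri \<Rightarrow> tri" where
  "x * y = Tri (tri_re x * tri_re y)
     (\<lambda>t. real_of_nnreal (tri_re x) * tri_eps y t + real_of_nnreal (tri_re y) * tri_eps x t)"

instance
  by standard
     (simp_all add: zero_tri_def one_tri_def plus_tri_def times_tri_def fun_eq_iff algebra_simps
        zero_nnreal.rep_eq one_nnreal.rep_eq plus_nnreal.rep_eq times_nnreal.rep_eq)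

end

datatype pole = Red | Green | Blue

instance pole :: finite
proof
  have "(UNIV :: pole set) = {Red, Green, Blue}"
    using pole.exhaust by auto
  then show "finite (UNIV :: pole set)"
    by (metis finite.emptyI finite_insert)
qed

text \<open>
  The poles are the complex cube roots of unity below. In an expression
  \<open>R \<tau>\<^sub>1 + G \<tau>\<^sub>2 + B \<tau>\<^sub>3\<close> they occur only as formal labels; their position in the
  complex plane, through \<open>R + G + B = 0\<close>, is what motivates the Cancellation law.
\<close>

fun pole_point :: "pole \<Rightarrow> complex" where
  "pole_point Red = 1"
| "pole_point Green = Complex (- 1 / 2) (sqrt 3 / 2)"
| "pole_point Blue = Complex (- 1 / 2) (- sqrt 3 / 2)"

lemma inj_pole_point: "inj pole_point"
proof (rule injI)
  fix p q show "pole_point p = pole_point q \<Longrightarrow> p = q"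
    by (cases p; cases q) (auto simp: complex_eq_iff)
qed

lemma sum_pole_point: "pole_point Red + pole_point Green + pole_point Blue = 0"
  by (simp add: complex_eq_iff)

text \<open>
  An expression is its family of coefficients. This is the colour space before the
  Cancellation law is imposed.
\<close>

type_synonym expr = "pole \<Rightarrow> tri"

fun RGB :: "tri \<Rightarrow> tri \<Rightarrow> tri \<Rightarrow> expr" where
  "RGB a b c Red = a"
| "RGB a b c Green = b"
| "RGB a b c Blue = c"

definition cancel :: "(expr \<times> expr) set" where
  "cancel = {(x, y). \<exists>\<tau> \<tau>'. \<forall>p. x p + \<tau> = y p + \<tau>'}"

lemma equiv_cancel: "equiv UNIV cancel"
proof (rule equivI)
  show "cancel \<subseteq> UNIV \<times> UNIV" by simp
  show "refl cancel" by (auto simp: refl_on_def cancel_def)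
  show "sym cancel" unfolding sym_def cancel_def mem_Collect_eq case_prod_conv by metis
  show "trans cancel"
  proof (rule transI)
    fix x y z assume "(x, y) \<in> cancel" "(y, z) \<in> cancel"
    then obtain a b c d where ab: "\<And>p. x p + a = y p + b" and cd: "\<And>p. y p + c = z p + d"
      unfolding cancel_def by auto
    have "x p + (a + c) = z p + (d + b)" for p
    proof -
      have "x p + (a + c) = (y p + b) + c" by (metis ab add.assoc)
      also have "\<dots> = (y p + c) + b" by (simp add: ac_simps)
      also have "\<dots> = (z p + d) + b" by (simp only: cd)
      finally show ?thesis by (simp only: add.assoc)
    qed
    then show "(x, z) \<in> cancel" unfolding cancel_def by blast
  qed
qed

definition cls :: "expr \<Rightarrow> expr set" where
  "cls x = cancel `` {x}"

definition expr_zero :: "expr set" where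
  "expr_zero = {RGB \<tau> \<tau> \<tau> | \<tau>. True}"

definition expr_add :: "expr \<Rightarrow> expr \<Rightarrow> expr" where
  "expr_add x y = (\<lambda>p. x p + y p)"

definition expr_neg :: "expr \<Rightarrow> expr" where
  "expr_neg x = RGB (x Green + x Blue) (x Red + x Blue) (x Red + x Green)"

fun latin1 :: "pole \<Rightarrow> pole \<Rightarrow> pole" where
  "latin1 Red Red = Red"
| "latin1 Red Green = Green"
| "latin1 Red Blue = Blue"
| "latin1 Green Red = Green"
| "latin1 Green Green = Blue"
| "latin1 Green Blue = Red"
| "latin1 Blue Red = Blue"
| "latin1 Blue Green = Red"
| "latin1 Blue Blue = Green"

fun latin2 :: "pole \<Rightarrow> pole \<Rightarrow> pole" where
  "latin2 Red Red = Green"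
| "latin2 Red Green = Blue"
| "latin2 Red Blue = Red"
| "latin2 Green Red = Blue"
| "latin2 Green Green = Red"
| "latin2 Green Blue = Green"
| "latin2 Blue Red = Red"
| "latin2 Blue Green = Green"
| "latin2 Blue Blue = Blue"

fun latin3 :: "pole \<Rightarrow> pole \<Rightarrow> pole" where
  "latin3 Red Red = Blue"
| "latin3 Red Green = Red"
| "latin3 Red Blue = Green"
| "latin3 Green Red = Red"
| "latin3 Green Green = Green"
| "latin3 Green Blue = Blue"
| "latin3 Blue Red = Green"
| "latin3 Blue Green = Blue"
| "latin3 Blue Blue = Red"

definition neutral_pole :: "(pole \<Rightarrow> pole \<Rightarrow> pole) \<Rightarrow> pole" where
  "neutral_pole sq = (THE e. \<forall>p. sq e p = p \<and> sq p e = p)"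

lemma all_pole: "(\<forall>p. P p) \<longleftrightarrow> P Red \<and> P Green \<and> P Blue"
  by (metis pole.exhaust)

lemma neutral_pole_latin:
  "neutral_pole latin1 = Red" "neutral_pole latin2 = Blue" "neutral_pole latin3 = Green"
proof -
  show "neutral_pole latin1 = Red"
    unfolding neutral_pole_def
  proof (rule the_equality)
    fix e assume "\<forall>p. latin1 e p = p \<and> latin1 p e = p"
    then show "e = Red" by (cases e) (auto simp: all_pole)
  qed (simp add: all_pole)
  show "neutral_pole latin2 = Blue"
    unfolding neutral_pole_def
  proof (rule the_equality)
    fix e assume "\<forall>p. latin2 e p = p \<and> latin2 p e = p"
    then show "e = Blue" by (cases e) (auto simp: all_pole)
  qed (simp add: all_pole)
  show "neutral_pole latin3 = Green"
    unfolding neutral_pole_def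
  proof (rule the_equality)
    fix e assume "\<forall>p. latin3 e p = p \<and> latin3 p e = p"
    then show "e = Green" by (cases e) (auto simp: all_pole)
  qed (simp add: all_pole)
qed

definition expr_one :: "(pole \<Rightarrow> pole \<Rightarrow> pole) \<Rightarrow> expr" where
  "expr_one sq = (\<lambda>p. if p = neutral_pole sq then 1 else 0)"

text \<open>
  Collecting, pole by pole, the double sum of the terms
  \<open>[A\<^sup>i \<otimes> A\<^sup>j] (\<tau>\<^sub>i \<cdot> \<tau>'\<^sub>j)\<close>.
\<close>

definition expr_mult :: "(pole \<Rightarrow> pole \<Rightarrow> pole) \<Rightarrow> expr \<Rightarrow> expr \<Rightarrow> expr" where
  "expr_mult sq x y = (\<lambda>p. \<Sum>(i, j) | sq i j = p. x i * y j)"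

text \<open>
  The colour space modulo the Cancellation law. Operations on classes are defined by
  uniting over all representatives. The zero is literally the set of expressions
  \<open>R \<tau> + G \<tau> + B \<tau>\<close>, which is itself one of the classes.
\<close>

definition colour_ring :: "(pole \<Rightarrow> pole \<Rightarrow> pole) \<Rightarrow> expr set ring" where
  "colour_ring sq =
    \<lparr>carrier = UNIV // cancel,
     mult = (\<lambda>X Y. \<Union>x\<in>X. \<Union>y\<in>Y. cls (expr_mult sq x y)),
     one = cls (expr_one sq),
     zero = expr_zero,
     add = (\<lambda>X Y. \<Union>x\<in>X. \<Union>y\<in>Y. cls (expr_add x y))\<rparr>"

definition expr_S :: "expr set" where
  "expr_S = {RGB (Tri a \<rho>) (Tri a \<gamma>) (Tri a \<beta>) | a \<rho> \<gamma> \<beta>. True}"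

text \<open>
  \<open>expr_S\<close> is a union of classes of \<open>cancel\<close>, so that \<open>x \<in> expr_S\<close> holds exactly when
  \<open>cls x \<in> colour_S\<close>.
\<close>

definition colour_S :: "expr set set" where
  "colour_S = cls ` expr_S"

definition is_quotient :: "('a, 'b) ring_scheme \<Rightarrow> 'a \<Rightarrow> 'a \<Rightarrow> 'a \<Rightarrow> bool" where
  "is_quotient K x y w \<longleftrightarrow>
     (\<exists>z\<in>carrier K. y \<otimes>\<^bsub>K\<^esub> z = \<one>\<^bsub>K\<^esub> \<and> w = x \<otimes>\<^bsub>K\<^esub> z)"

end

theory Submission
  imports Defs
begin

text \<open>
  The Cancellation law identifies expressions that differ by a multiple of \<open>R + G + B\<close>, and the poles,
  read as complex numbers, satisfy \<open>R + G + B = 0\<close> and no other real linear relation. So the class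
  of an expression is determined by the number obtained when the poles are read as complex numbers.
  As each coefficient \<open>q + \<psi>\<epsilon>\<close> is a dual number, this number is a complex dual number \<open>z + \<phi>\<epsilon>\<close> with
  \<open>z\<close> complex and \<open>\<phi>\<close> a complex-valued function. Every such number arises: the coefficients \<open>q\<close>
  have to be nonnegative, but adding a multiple of \<open>R + G + B\<close> achieves this.

  The poles are the cube roots of unity. The first Latin square is their multiplication table; in the
  other two, dividing every pole by the neutral one (that is, rotating the triangle) turns the Latin
  square into this table. With the poles rotated in this way, evaluation (\<open>val\<close>) takes
  \<open>\<oplus>\<close> and \<open>\<odot>\<close> to the addition and multiplication of complex dual numbers
  (\<open>val_add\<close>, \<open>val_mult\<close>), is onto (\<open>val_surj\<close>) and identifies exactly the expressions that the
  Cancellation law identifies (\<open>val_eq_iff_cancel\<close>). So for all three squares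
  the colour ring is isomorphic to the ring of complex dual numbers.

  In that ring \<open>\<SS>\<close> is the set of numbers \<open>0 + \<phi>\<epsilon>\<close> (\<open>colour_S_eq\<close>), and \<open>z + \<phi>\<epsilon>\<close> is invertible as
  soon as \<open>z \<noteq> 0\<close>, because \<open>\<epsilon>\<^sup>2 = 0\<close>. Hence \<open>\<SS>\<close> is an ideal whose complement consists of units. Such
  an ideal is maximal, which makes the quotient a field (it is the field of complex numbers), and
  division by anything outside \<open>\<SS>\<close> is possible and unique.
\<close>

section \<open>Complex dual numbers\<close>

text \<open>
  \<open>Dualc z \<phi>\<close> stands for \<open>z + \<phi>\<epsilon>\<close>: the coefficients of the colour space with the real numbers
  replaced by complex ones, so that subtraction and the poles become available. The names of the
  two parts are those used for supernumbers.
\<close>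

datatype dualc = Dualc (body: complex) (soul: "nnreal \<Rightarrow> complex")

instantiation dualc :: comm_ring_1
begin

definition zero_dualc :: dualc where "0 = Dualc 0 (\<lambda>t. 0)"

definition one_dualc :: dualc where "1 = Dualc 1 (\<lambda>t. 0)"

definition plus_dualc :: "dualc \<Rightarrow> dualc \<Rightarrow> dualc" where
  "c + d = Dualc (body c + body d) (\<lambda>t. soul c t + soul d t)"

definition uminus_dualc :: "dualc \<Rightarrow> dualc" where
  "- c = Dualc (- body c) (\<lambda>t. - soul c t)"

definition minus_dualc :: "dualc \<Rightarrow> dualc \<Rightarrow> dualc" where
  "c - d = Dualc (body c - body d) (\<lambda>t. soul c t - soul d t)"

definition times_dualc :: "dualc \<Rightarrow> dualc \<Rightarrow> dualc" where
  "c * d = Dualc (body c * body d) (\<lambda>t. body c * soul d t + body d * soul c t)"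

instance
  by standard
    (simp_all add: zero_dualc_def one_dualc_def plus_dualc_def uminus_dualc_def
      minus_dualc_def times_dualc_def fun_eq_iff algebra_simps)

end

lemma dualc_simps [simp]:
  "body 0 = 0" "body 1 = 1" "body (c + d) = body c + body d" "body (- c) = - body c"
  "body (c * d) = body c * body d"
  "soul 0 t = 0" "soul 1 t = 0" "soul (c + d) t = soul c t + soul d t" "soul (- c) t = - soul c t"
  "soul (c * d) t = body c * soul d t + body d * soul c t"
  by (simp_all add: zero_dualc_def one_dualc_def plus_dualc_def uminus_dualc_def times_dualc_def)

lemma dualc_eq_iff: "c = d \<longleftrightarrow> body c = body d \<and> (\<forall>t. soul c t = soul d t)"
  by (cases c; cases d) (auto simp: fun_eq_iff)

lemma dualc_unit:
  assumes "body d \<noteq> 0"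
  obtains e where "d * e = 1"
proof
  \<comment> \<open>\<open>(z + \<phi>\<epsilon>)\<^sup>-\<^sup>1 = z\<^sup>-\<^sup>1 (1 - z\<^sup>-\<^sup>1\<phi>\<epsilon>)\<close>, since \<open>\<epsilon>\<^sup>2 = 0\<close>\<close>
  show "d * Dualc (inverse (body d)) (\<lambda>t. - soul d t / (body d)\<^sup>2) = 1"
    using assms by (simp add: dualc_eq_iff field_simps power2_eq_square)
qed

definition scalar :: "complex \<Rightarrow> dualc" where
  "scalar c = Dualc c (\<lambda>t. 0)"

lemma scalar_simps [simp]: "body (scalar c) = c" "soul (scalar c) t = 0"
  by (simp_all add: scalar_def)

lemma scalar_one: "scalar 1 = 1"
  and scalar_mult: "scalar (c * d) = scalar c * scalar d"
  by (simp_all add: dualc_eq_iff)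

definition coeff_embed :: "tri \<Rightarrow> dualc" where
  "coeff_embed \<tau> = Dualc (of_real (real_of_nnreal (tri_re \<tau>))) (\<lambda>t. of_real (tri_eps \<tau> t))"

lemma coeff_embed_simps [simp]:
  "body (coeff_embed \<tau>) = of_real (real_of_nnreal (tri_re \<tau>))"
  "soul (coeff_embed \<tau>) t = of_real (tri_eps \<tau> t)"
  by (simp_all add: coeff_embed_def)

lemma coeff_embed_hom:
  shows coeff_embed_0: "coeff_embed 0 = 0"
    and coeff_embed_1: "coeff_embed 1 = 1"
    and coeff_embed_add: "coeff_embed (\<sigma> + \<tau>) = coeff_embed \<sigma> + coeff_embed \<tau>"
    and coeff_embed_mult: "coeff_embed (\<sigma> * \<tau>) = coeff_embed \<sigma> * coeff_embed \<tau>"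
  by (simp_all add: dualc_eq_iff zero_tri_def one_tri_def plus_tri_def times_tri_def
      zero_nnreal.rep_eq one_nnreal.rep_eq plus_nnreal.rep_eq times_nnreal.rep_eq)

lemma coeff_embed_sum: "coeff_embed (sum f A) = (\<Sum>i\<in>A. coeff_embed (f i))"
  by (induction A rule: infinite_finite_induct) (simp_all add: coeff_embed_hom)

lemma tri_eq_iff:
  "\<sigma> = \<tau> \<longleftrightarrow> real_of_nnreal (tri_re \<sigma>) = real_of_nnreal (tri_re \<tau>) \<and> (\<forall>t. tri_eps \<sigma> t = tri_eps \<tau> t)"
  by (cases \<sigma>; cases \<tau>) (auto simp: fun_eq_iff real_of_nnreal_inject)

section \<open>Evaluating expressions at the poles\<close>

lemma sum_pole: "(\<Sum>p\<in>UNIV. f p) = f Red + f Green + (f Blue :: 'a :: comm_monoid_add)"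
proof -
  have "(UNIV :: pole set) = {Red, Green, Blue}" using pole.exhaust by auto
  then have "sum f UNIV = sum f {Red, Green, Blue}" by (rule arg_cong)
  then show ?thesis by (simp add: add.assoc)
qed

lemma pole_point_nonzero: "pole_point p \<noteq> 0"
  by (cases p) (auto simp: complex_eq_iff)

text \<open>
  The only real relations among the poles are the multiples of \<open>R + G + B = 0\<close>. That \<open>f\<close> and \<open>g\<close>
  differ by a constant is written without subtraction, so as to match the Cancellation law.
\<close>

lemma pole_combination_eq_iff:
  fixes f g :: "pole \<Rightarrow> real"
  shows "(\<Sum>p\<in>UNIV. pole_point p * of_real (f p)) = (\<Sum>p\<in>UNIV. pole_point p * of_real (g p))
     \<longleftrightarrow> (\<forall>p. f p + g Red = g p + f Red)"
proof -
  have im: "sqrt 3 * x - sqrt 3 * y = sqrt 3 * z - sqrt 3 * w \<longleftrightarrow> x - y = z - w" for x y z w :: real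
    by (simp add: right_diff_distrib [symmetric])
  show ?thesis
    using im [of "f Green" "f Blue" "g Green" "g Blue"]
    by (auto simp: sum_pole complex_eq_iff all_pole field_simps)
qed

lemma pole_combination_surj:
  obtains f where "\<And>p. 0 \<le> f p" "(\<Sum>p\<in>UNIV. pole_point p * of_real (f p)) = w"
proof
  \<comment> \<open>\<open>w = Re w \<cdot> R + (Im w / \<surd>3) \<cdot> (G - B)\<close>; adding a multiple of \<open>R + G + B = 0\<close> makes the
    coefficients nonnegative.\<close>
  define s where "s = Im w / sqrt 3"
  define k where "k = \<bar>Re w\<bar> + \<bar>s\<bar>"
  define f where "f = (\<lambda>p. case p of Red \<Rightarrow> k + Re w | Green \<Rightarrow> k + s
    | Blue \<Rightarrow> k - s)"
  show "0 \<le> f p" for p by (cases p) (auto simp: f_def k_def)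
  show "(\<Sum>p\<in>UNIV. pole_point p * of_real (f p)) = w"
    by (simp add: sum_pole f_def s_def complex_eq_iff field_simps)
qed

text \<open>
  The poles rotated so that the neutral pole of the Latin square lies at \<open>1\<close>.
\<close>

definition pole_root :: "(pole \<Rightarrow> pole \<Rightarrow> pole) \<Rightarrow> pole \<Rightarrow> complex" where
  "pole_root sq p = pole_point p / pole_point (neutral_pole sq)"

text \<open>
  Each of the three Latin squares is the multiplication table of the cube roots of unity, up to
  the rotation.
\<close>

lemma pole_root_latin:
  assumes "sq \<in> {latin1, latin2, latin3}"
  shows "pole_root sq (sq p q) = pole_root sq p * pole_root sq q"
  using assms
  by (cases p; cases q)
    (auto simp: pole_root_def neutral_pole_latin complex_eq_iff field_simps Re_divide Im_divide power2_eq_square)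

definition val :: "(pole \<Rightarrow> pole \<Rightarrow> pole) \<Rightarrow> expr \<Rightarrow> dualc" where
  "val sq x = (\<Sum>p\<in>UNIV. scalar (pole_root sq p) * coeff_embed (x p))"

lemma body_val:
  "body (val sq x) =
    (\<Sum>p\<in>UNIV. pole_point p * of_real (real_of_nnreal (tri_re (x p)))) / pole_point (neutral_pole sq)"
  by (simp add: val_def sum_pole pole_root_def add_divide_distrib)

lemma soul_val:
  "soul (val sq x) t =
    (\<Sum>p\<in>UNIV. pole_point p * of_real (tri_eps (x p) t)) / pole_point (neutral_pole sq)"
  by (simp add: val_def sum_pole pole_root_def add_divide_distrib)

lemma val_add: "val sq (expr_add x y) = val sq x + val sq y"
  by (simp add: val_def expr_add_def coeff_embed_add distrib_left sum.distrib)

lemma val_one: "val sq (expr_one sq) = 1"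
proof -
  have "val sq (expr_one sq) = (\<Sum>p\<in>UNIV. if p = neutral_pole sq then scalar (pole_root sq p) else 0)"
    unfolding val_def expr_one_def by (intro sum.cong) (auto simp: coeff_embed_hom)
  then show ?thesis by (simp add: pole_root_def pole_point_nonzero scalar_one)
qed

text \<open>
  Equal values mean that the coefficients of \<open>x\<close> and \<open>y\<close> differ by the same amount at each pole,
  namely by their difference at \<open>Red\<close>. So \<open>\<tau> = y Red\<close> and \<open>\<tau>' = x Red\<close> serve as the summands in
  the Cancellation law.
\<close>

lemma val_eq_iff_cancel: "val sq x = val sq y \<longleftrightarrow> (x, y) \<in> cancel"
proof -
  have "val sq x = val sq y \<longleftrightarrow> (\<forall>p. x p + y Red = y p + x Red)"
    by (auto simp: dualc_eq_iff body_val soul_val pole_point_nonzero pole_combination_eq_iff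
        tri_eq_iff plus_tri_def plus_nnreal.rep_eq)
  moreover have "x p + y Red = y p + x Red" if "\<forall>p. x p + \<tau> = y p + \<tau>'" for p \<tau> \<tau>'
  proof -
    have "x p + \<tau> = y p + \<tau>'" "x Red + \<tau> = y Red + \<tau>'" using that by auto
    then show ?thesis
      by (auto simp: tri_eq_iff plus_tri_def plus_nnreal.rep_eq) (smt (verit))+
  qed
  ultimately show ?thesis
    unfolding cancel_def by auto
qed

lemma val_surj: "\<exists>x. val sq x = d"
proof -
  let ?n = "pole_point (neutral_pole sq)"
  obtain f where f: "\<And>p. 0 \<le> f p" "(\<Sum>p\<in>UNIV. pole_point p * of_real (f p)) = body d * ?n"
    using pole_combination_surj by blast
  have "\<exists>g. (\<Sum>p\<in>UNIV. pole_point p * of_real (g p)) = soul d t * ?n" for t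
    using pole_combination_surj by metis
  then obtain g where g: "\<And>t. (\<Sum>p\<in>UNIV. pole_point p * of_real (g t p)) = soul d t * ?n"
    by metis
  have "val sq (\<lambda>p. Tri (Abs_nnreal (f p)) (\<lambda>t. g t p)) = d"
    using f g by (simp add: dualc_eq_iff body_val soul_val Abs_nnreal_inverse pole_point_nonzero)
  then show ?thesis by blast
qed

lemma val_eq_0_iff: "val sq x = 0 \<longleftrightarrow> x \<in> expr_zero"
proof -
  have "val sq (\<lambda>p. 0) = 0" by (simp add: val_def coeff_embed_0)
  then have "val sq x = 0 \<longleftrightarrow> (\<forall>p. x p = x Red)"
    using val_eq_iff_cancel [of sq x "\<lambda>p. 0"]
    by (auto simp: dualc_eq_iff body_val soul_val pole_point_nonzero tri_eq_iff
      pole_combination_eq_iff [where g = "\<lambda>p. 0", simplified])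
  also have "\<dots> \<longleftrightarrow> x = RGB (x Red) (x Red) (x Red)"
    by (auto simp: fun_eq_iff all_pole)
  also have "\<dots> \<longleftrightarrow> x \<in> expr_zero"
    by (auto simp: expr_zero_def)
  finally show ?thesis .
qed

lemma body_val_eq_0_iff: "body (val sq x) = 0 \<longleftrightarrow> x \<in> expr_S"
proof -
  have "body (val sq x) = 0 \<longleftrightarrow> (\<forall>p. tri_re (x p) = tri_re (x Red))"
    by (simp add: body_val pole_point_nonzero real_of_nnreal_inject
      pole_combination_eq_iff [where g = "\<lambda>p. 0", simplified])
  also have "\<dots> \<longleftrightarrow> x \<in> expr_S"
  proof
    assume "\<forall>p. tri_re (x p) = tri_re (x Red)"
    then have "x = RGB (Tri (tri_re (x Red)) (tri_eps (x Red))) (Tri (tri_re (x Red)) (tri_eps (x Green)))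
        (Tri (tri_re (x Red)) (tri_eps (x Blue)))"
      by (simp add: fun_eq_iff all_pole tri.expand)
    then show "x \<in> expr_S" unfolding expr_S_def by blast
  qed (auto simp: expr_S_def all_pole)
  finally show ?thesis .
qed

lemma val_neg: "val sq (expr_neg x) = - val sq x"
proof -
  \<comment> \<open>\<open>x \<oplus> \<ominus>x\<close> has the same coefficient, the sum of those of \<open>x\<close>, at each pole.\<close>
  have "expr_add x (expr_neg x) \<in> expr_zero"
    unfolding expr_zero_def
    by (auto simp: expr_add_def expr_neg_def fun_eq_iff all_pole ac_simps)
  then have "val sq x + val sq (expr_neg x) = 0"
    by (simp add: val_eq_0_iff [of sq, symmetric] val_add)
  then show ?thesis by (simp add: add_eq_0_iff)
qed

section \<open>The colour ring as a ring of dual numbers\<close>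

text \<open>
  The ring structure depends on the Latin square only through the multiplicativity of the rotated
  poles, so the three cases are treated at once.
\<close>

locale multiplicative_poles =
  fixes sq :: "pole \<Rightarrow> pole \<Rightarrow> pole"
  assumes pole_root_mult: "pole_root sq (sq p q) = pole_root sq p * pole_root sq q"
begin

text \<open>
  Grouping the double sum by the value of \<open>sq i j\<close> is undone, after which the sum over all pairs
  factors.
\<close>

lemma val_mult: "val sq (expr_mult sq x y) = val sq x * val sq y"
proof -
  let ?s = "\<lambda>p. scalar (pole_root sq p)" and ?c = coeff_embed
  have "val sq (expr_mult sq x y) =
      (\<Sum>p\<in>UNIV. \<Sum>(i, j) | sq i j = p. ?s (sq i j) * ?c (x i * y j))"
    unfolding val_def expr_mult_def coeff_embed_sum sum_distrib_left
    by (intro sum.cong refl) auto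
  also have "\<dots> = (\<Sum>(i, j)\<in>UNIV. ?s (sq i j) * ?c (x i * y j))"
    using sum.group [of UNIV UNIV "\<lambda>(i, j). sq i j" "\<lambda>(i, j). ?s (sq i j) * ?c (x i * y j)"]
    by (simp add: case_prod_unfold)
  also have "\<dots> = (\<Sum>(i, j)\<in>UNIV \<times> UNIV. (?s i * ?c (x i)) * (?s j * ?c (y j)))"
    unfolding UNIV_Times_UNIV
    by (intro sum.cong refl) (auto simp: pole_root_mult scalar_mult coeff_embed_mult mult_ac)
  also have "\<dots> = val sq x * val sq y"
    by (simp add: val_def sum_product sum.cartesian_product)
  finally show ?thesis .
qed

text \<open>
  The classes of the Cancellation law are the fibres of \<open>val\<close>. Labelling a class by its value instead of
  by a representative makes \<open>fibre\<close> a ring isomorphism from the complex dual numbers onto the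
  colour ring, and all ring laws are transported along it.
\<close>

definition fibre :: "dualc \<Rightarrow> expr set" where
  "fibre d = {x. val sq x = d}"

lemma cls_eq_fibre: "cls x = fibre (val sq x)"
  by (auto simp: cls_def fibre_def val_eq_iff_cancel [of sq, symmetric])

lemma fibre_nonempty: "fibre d \<noteq> {}"
  using val_surj by (auto simp: fibre_def)

lemma fibre_eq_iff [simp]: "fibre c = fibre d \<longleftrightarrow> c = d"
proof
  assume eq: "fibre c = fibre d"
  obtain x where "x \<in> fibre c" using fibre_nonempty by blast
  moreover have "x \<in> fibre d" using calculation unfolding eq .
  ultimately show "c = d" by (simp add: fibre_def)
qed simp

abbreviation D where "D \<equiv> colour_ring sq"

lemma carrier_D: "carrier D = range fibre"
proof -
  have "UNIV // cancel = range cls" by (auto simp: quotient_def cls_def)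
  also have "\<dots> = range fibre"
    using val_surj [of sq] by (auto simp: cls_eq_fibre image_iff) metis
  finally show ?thesis by (simp add: colour_ring_def)
qed

lemma fibre_closed [simp]: "fibre d \<in> carrier D"
  by (simp add: carrier_D)

text \<open>
  The operations on classes are unions over all representatives; they are well defined because
  the class of the result is the same for all of them.
\<close>

lemma union_of_constant_on_fibres:
  assumes "\<And>x y. x \<in> fibre c \<Longrightarrow> y \<in> fibre d \<Longrightarrow> F x y = A"
  shows "(\<Union>x\<in>fibre c. \<Union>y\<in>fibre d. F x y) = A"
  using assms fibre_nonempty [of c] fibre_nonempty [of d] by (force simp: ex_in_conv [symmetric])

lemma D_ops [simp]:
  shows D_add: "fibre c \<oplus>\<^bsub>D\<^esub> fibre d = fibre (c + d)"
    and D_mult: "fibre c \<otimes>\<^bsub>D\<^esub> fibre d = fibre (c * d)"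
    and D_one: "\<one>\<^bsub>D\<^esub> = fibre 1"
    and D_zero: "\<zero>\<^bsub>D\<^esub> = fibre 0"
proof -
  show "fibre c \<oplus>\<^bsub>D\<^esub> fibre d = fibre (c + d)"
    by (simp add: colour_ring_def) (rule union_of_constant_on_fibres,
        simp add: cls_eq_fibre val_add, simp add: fibre_def)
  show "fibre c \<otimes>\<^bsub>D\<^esub> fibre d = fibre (c * d)"
    by (simp add: colour_ring_def) (rule union_of_constant_on_fibres,
        simp add: cls_eq_fibre val_mult, simp add: fibre_def)
  show "\<one>\<^bsub>D\<^esub> = fibre 1"
    by (simp add: colour_ring_def cls_eq_fibre val_one)
  show "\<zero>\<^bsub>D\<^esub> = fibre 0"
    by (auto simp: colour_ring_def fibre_def val_eq_0_iff)
qed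

lemma colour_S_eq: "colour_S = fibre ` {d. body d = 0}"
proof -
  have "colour_S = (\<lambda>x. fibre (val sq x)) ` {x. body (val sq x) = 0}"
    by (simp add: colour_S_def cls_eq_fibre body_val_eq_0_iff)
  also have "\<dots> = fibre ` {d. body d = 0}"
    using val_surj [of sq] by (auto simp: image_iff) metis
  finally show ?thesis .
qed

lemma fibre_in_colour_S [simp]: "fibre d \<in> colour_S \<longleftrightarrow> body d = 0"
  by (auto simp: colour_S_eq)

lemma cring_D: "cring D"
proof (rule cringI)
  show "abelian_group D"
  proof (rule abelian_groupI)
    fix x assume "x \<in> carrier D"
    then obtain d where "x = fibre d" by (auto simp: carrier_D)
    then show "\<exists>y\<in>carrier D. y \<oplus>\<^bsub>D\<^esub> x = \<zero>\<^bsub>D\<^esub>"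
      by (intro bexI [of _ "fibre (- d)"]) auto
  qed (auto simp: carrier_D ac_simps)
  show "comm_monoid D"
    by (rule comm_monoidI) (auto simp: carrier_D ac_simps)
qed (auto simp: carrier_D algebra_simps)

sublocale cring D by (rule cring_D)

lemma a_inv_cls: "\<ominus>\<^bsub>D\<^esub> cls x = cls (expr_neg x)"
  by (rule minus_equality) (simp_all add: cls_eq_fibre val_neg)

lemma unit_outside_S:
  assumes "y \<in> carrier D - colour_S"
  obtains z where "z \<in> carrier D" "y \<otimes>\<^bsub>D\<^esub> z = \<one>\<^bsub>D\<^esub>"
proof -
  obtain d where d: "y = fibre d" "body d \<noteq> 0"
    using assms by (auto simp: carrier_D)
  obtain e where "d * e = 1" using dualc_unit d(2) by blast
  then show ?thesis using that [of "fibre e"] d by simp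
qed

lemma ex1_quotient:
  assumes "x \<in> carrier D" "y \<in> carrier D - colour_S"
  shows "\<exists>!w. w \<in> carrier D \<and> is_quotient D x y w"
proof -
  obtain z where z: "z \<in> carrier D" "y \<otimes>\<^bsub>D\<^esub> z = \<one>\<^bsub>D\<^esub>"
    using unit_outside_S assms(2) by blast
  have yD: "y \<in> carrier D" using assms(2) by blast
  have unique: "z' = z" if "z' \<in> carrier D" "y \<otimes>\<^bsub>D\<^esub> z' = \<one>\<^bsub>D\<^esub>" for z'
  proof (rule inv_unique)
    show "z' \<otimes>\<^bsub>D\<^esub> y = \<one>\<^bsub>D\<^esub>"
      using that(2) by (simp only: m_comm [OF that(1) yD])
  qed (fact that(1) yD z)+
  show ?thesis
  proof (rule ex1I)
    show "x \<otimes>\<^bsub>D\<^esub> z \<in> carrier D \<and> is_quotient D x y (x \<otimes>\<^bsub>D\<^esub> z)"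
      using m_closed [OF assms(1) z(1)] z unfolding is_quotient_def by blast
    show "w = x \<otimes>\<^bsub>D\<^esub> z" if "w \<in> carrier D \<and> is_quotient D x y w" for w
      using that unique unfolding is_quotient_def by blast
  qed
qed

lemma ideal_S: "ideal colour_S D"
proof (rule idealI)
  show "subgroup colour_S (add_monoid D)"
  proof (rule add.subgroupI)
    have "fibre 0 \<in> colour_S" by simp
    then show "colour_S \<noteq> {}" by blast
    fix x assume "x \<in> colour_S"
    then obtain d where d: "x = fibre d" "body d = 0" by (auto simp: colour_S_eq)
    have "\<ominus>\<^bsub>D\<^esub> x = fibre (- d)" by (rule minus_equality) (simp_all add: d)
    then show "\<ominus>\<^bsub>D\<^esub> x \<in> colour_S" by (simp add: d)
  qed (auto simp: colour_S_eq carrier_D)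
qed (auto simp: colour_S_eq carrier_D ring_axioms)

text \<open>
  An ideal that strictly contains \<open>\<SS>\<close> contains a unit, hence is the whole ring.
\<close>

lemma maximalideal_S: "maximalideal colour_S D"
proof (rule maximalidealI [OF ideal_S])
  show "carrier D \<noteq> colour_S"
  proof
    assume "carrier D = colour_S"
    then have "fibre 1 \<in> colour_S" using fibre_closed [of 1] by blast
    then show False by simp
  qed
next
  fix J assume J: "ideal J D" "colour_S \<subseteq> J" "J \<subseteq> carrier D"
  then interpret J: ideal J D by simp
  show "J = colour_S \<or> J = carrier D"
  proof (cases "J \<subseteq> colour_S")
    case False
    then obtain y where y: "y \<in> J" "y \<in> carrier D - colour_S" using J(3) by auto
    then obtain z where "z \<in> carrier D" "y \<otimes>\<^bsub>D\<^esub> z = \<one>\<^bsub>D\<^esub>" using unit_outside_S by blast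
    then have "\<one>\<^bsub>D\<^esub> \<in> J" using J.I_r_closed y(1) by metis
    then show ?thesis using J.one_imp_carrier by blast
  qed (use J(2) in blast)
qed

lemma field_quotient: "field (D Quot colour_S)"
  by (rule maximalideal.quotient_is_field [OF maximalideal_S cring_D])

end

theorem theorem5p1:
  fixes sq :: "pole \<Rightarrow> pole \<Rightarrow> pole"
    and D :: "expr set ring"
  assumes "sq \<in> {latin1, latin2, latin3}"
    and "D = colour_ring sq"
  shows
    "(cring D \<and>
        (\<forall>x\<in>carrier D. \<forall>y\<in>carrier D - colour_S. \<exists>!w. w \<in> carrier D \<and> is_quotient D x y w)) \<and>
     (abelian_group D \<and>
        (\<forall>x. \<ominus>\<^bsub>D\<^esub> (cls x) = cls (expr_neg x))) \<and>
     (ideal colour_S D \<and>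
        comm_group (mult_of (D Quot colour_S)) \<and>
        \<one>\<^bsub>mult_of (D Quot colour_S)\<^esub> = colour_S +>\<^bsub>D\<^esub> \<one>\<^bsub>D\<^esub>) \<and>
     (\<forall>x\<in>carrier D. \<forall>y\<in>carrier D. \<forall>z\<in>carrier D.
        x \<otimes>\<^bsub>D\<^esub> (y \<oplus>\<^bsub>D\<^esub> z) = (x \<otimes>\<^bsub>D\<^esub> y) \<oplus>\<^bsub>D\<^esub> (x \<otimes>\<^bsub>D\<^esub> z) \<and>
        (y \<oplus>\<^bsub>D\<^esub> z) \<otimes>\<^bsub>D\<^esub> x = (y \<otimes>\<^bsub>D\<^esub> x) \<oplus>\<^bsub>D\<^esub> (z \<otimes>\<^bsub>D\<^esub> x)) \<and>
     (field (D Quot colour_S) \<and>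
        \<zero>\<^bsub>D Quot colour_S\<^esub> = colour_S \<and>
        \<one>\<^bsub>D Quot colour_S\<^esub> = colour_S +>\<^bsub>D\<^esub> \<one>\<^bsub>D\<^esub>)"
proof -
  interpret multiplicative_poles sq
    by unfold_locales (rule pole_root_latin [OF assms(1)])
  have D: "D = colour_ring sq" by fact
  interpret Q: field "colour_ring sq Quot colour_S" by (rule field_quotient)
  show ?thesis
    unfolding D
  proof (intro conjI ballI allI)
    show "comm_group (mult_of (colour_ring sq Quot colour_S))"
      by (rule group.group_comm_groupI [OF Q.field_mult_group]) (simp add: Q.m_comm)
  qed (simp_all add: cring_D ex1_quotient abelian_group_axioms a_inv_cls ideal_S r_distr l_distr
      Q.field_axioms, simp_all add: FactRing_def)
qed

end
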